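(* Let $p>3$ be a prime, let $a\in\mathbb Z_p$ with $a\not\equiv 0\pmod p$. Then $$\sum_{k=1}^{p-1}\frac{(-1)^k}k\binom ak\equiv \frac{B_{p^2(p-1)}-B_{p^2(p-1)}(-a)}{p^2(p-1)}+\frac{a-\langle a\rangle_p}2B_{p-2}(-a)\pmod{p^2}.$$
   Context: $\mathbb Z_p$ denotes the set of rational numbers whose denominator is not divisible by $p$. For $x,y\in\mathbb Q$, $x\equiv y\pmod{p^m}$ means $(x-y)/p^m\in\mathbb Z_p$. For $a\in\mathbb Z_p$, $\langle a\rangle_p\in\{0,1,\ldots,p-1\}$ is defined by $a\equiv\langle a\rangle_p\pmod p$. For rational $a$ and integer $k\ge0$, $\binom ak=a(a-1)\cdots(a-k+1)/k!$. The Bernoulli numbers are defined by $B_0=1$, $\sum_{k=0}^{n-1}\binom nkB_k=0$ for $n\ge2$, and the Bernoulli polynomials by $B_n(x)=\sum_{k=0}^n\binom nkB_kx^{n-k}$. *)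

theory Defs
  imports Complex_Main "HOL-Number_Theory.Cong"
begin

(* The ring of p-integral rationals; quotient_of returns the reduced
   fraction with positive denominator. *)
definition Zloc :: "nat \<Rightarrow> rat set" where
  "Zloc p = {x. \<not> int p dvd snd (quotient_of x)}"

(* qcong p m x y: x and y are congruent modulo p ^ m.  The arguments are arbitrary
   rationals and need not be p-integral themselves. *)
definition qcong :: "nat \<Rightarrow> nat \<Rightarrow> rat \<Rightarrow> rat \<Rightarrow> bool" where
  "qcong p m x y \<longleftrightarrow> (x - y) / of_nat p ^ m \<in> Zloc p"

(* Least nonnegative residue; well defined for p-integral a by ex1_qresidue below. *)
definition qresidue :: "nat \<Rightarrow> rat \<Rightarrow> nat" where
  "qresidue p a = (THE r. r < p \<and> qcong p 1 a (of_nat r))"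

(* The recurrence of bernoulli_recurrence below, with n + 1 for n, solved for its last term. *)
fun bernoulli :: "nat \<Rightarrow> rat" where
  "bernoulli n = (if n = 0 then 1 else
     - (\<Sum>k<n. of_nat (Suc n choose k) * bernoulli k) / of_nat (Suc n))"

declare bernoulli.simps [simp del]

definition bernpoly :: "nat \<Rightarrow> rat \<Rightarrow> rat" where
  "bernpoly n x = (\<Sum>k\<le>n. of_nat (n choose k) * bernoulli k * x ^ (n - k))"

lemma bernoulli_0: "bernoulli 0 = 1"
  by (simp add: bernoulli.simps)

lemma bernoulli_recurrence:
  assumes "n \<ge> 2"
  shows "(\<Sum>k<n. of_nat (n choose k) * bernoulli k) = 0"
proof -
  obtain m where m: "n = Suc m" "m \<noteq> 0"
    using assms by (cases n) auto
  have "bernoulli m * of_nat (Suc m) = - (\<Sum>k<m. of_nat (Suc m choose k) * bernoulli k)"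
    using m(2) by (subst bernoulli.simps) (simp del: of_nat_Suc)
  then show ?thesis
    by (simp add: m(1) algebra_simps)
qed

lemma Zloc_iff:
  "x \<in> Zloc p \<longleftrightarrow> (\<exists>n d. \<not> int p dvd d \<and> x = of_int n / of_int d)"
proof
  assume "x \<in> Zloc p"
  moreover obtain n d where nd: "quotient_of x = (n, d)" by fastforce
  ultimately show "\<exists>n d. \<not> int p dvd d \<and> x = of_int n / of_int d"
    using quotient_of_div[OF nd] by (auto simp: Zloc_def)
next
  assume "\<exists>n d. \<not> int p dvd d \<and> x = of_int n / of_int d"
  then obtain n d where nd: "\<not> int p dvd d" "x = of_int n / of_int d" by blast
  obtain n' d' where q: "quotient_of x = (n', d')" by fastforce
  have d: "d \<noteq> 0" "d' > 0" using nd(1) quotient_of_denom_pos[OF q] by auto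
  have "(of_int n :: rat) / of_int d = of_int n' / of_int d'"
    using quotient_of_div[OF q] nd(2) by simp
  then have "(of_int (n * d') :: rat) = of_int (n' * d)"
    using d by (simp add: field_simps)
  then have "n * d' = n' * d" by (simp only: of_int_eq_iff)
  then have "d' dvd n' * d" by (metis dvd_triv_right)
  then have "d' dvd d"
    using quotient_of_coprime[OF q] by (simp add: coprime_commute coprime_dvd_mult_right_iff)
  then show "x \<in> Zloc p" using nd(1) q by (auto simp: Zloc_def dest: dvd_trans)
qed

lemma ex1_qresidue:
  assumes p: "prime p" and a: "a \<in> Zloc p"
  shows "\<exists>!r. r < p \<and> qcong p 1 a (of_nat r)"
proof -
  have ip: "prime (int p)" and p0: "p > 0" using p by (auto simp: prime_gt_0_nat)
  obtain n d where nd: "\<not> int p dvd d" "a = of_int n / of_int d"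
    using a Zloc_iff by blast
  have d0: "d \<noteq> 0" using nd(1) by auto
  have "coprime d (int p)"
    using prime_imp_coprime[OF ip nd(1)] by (simp only: coprime_commute)
  then obtain e where e: "[d * e = 1] (mod int p)" using cong_solve_coprime_int by blast
  have key: "qcong p 1 a (of_nat r) \<longleftrightarrow> int p dvd n - int r * d" for r
  proof
    assume "int p dvd n - int r * d"
    then obtain q where "n - int r * d = int p * q" by blast
    then have "n = int p * q + int r * d" by simp
    then have "(of_int n :: rat) = of_int (int p * q + int r * d)" by simp
    then have "(a - of_nat r) / of_nat p = of_int q / of_int d"
      using d0 p0 nd(2) by (simp add: field_simps)
    then show "qcong p 1 a (of_nat r)"
      unfolding qcong_def Zloc_iff using nd(1) by auto
  next
    assume "qcong p 1 a (of_nat r)"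
    then obtain u v where uv: "\<not> int p dvd v" "(a - of_nat r) / of_nat p = of_int u / of_int v"
      unfolding qcong_def Zloc_iff by auto
    have v0: "v \<noteq> 0" using uv(1) by auto
    have "(of_int ((n - int r * d) * v) :: rat) = of_int (int p * (u * d))"
      using uv(2) nd(2) d0 v0 p0 by (simp add: field_simps)
    then have "(n - int r * d) * v = int p * (u * d)" by (simp only: of_int_eq_iff)
    then have "int p dvd (n - int r * d) * v" by simp
    then show "int p dvd n - int r * d" using ip uv(1) by (simp add: prime_dvd_mult_iff)
  qed
  show ?thesis
  proof (rule ex1I[of _ "nat (n * e mod int p)"], intro conjI)
    show "nat (n * e mod int p) < p" using p0 by (simp add: nat_less_iff)
    have "[n * (d * e) = n * 1] (mod int p)" using e by (rule cong_scalar_left)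
    moreover have "[n * e mod int p * d = n * e * d] (mod int p)"
      by (simp add: cong_def mod_simps)
    ultimately have "[n * e mod int p * d = n] (mod int p)"
      by (simp add: ac_simps cong_def)
    then have "int p dvd n - n * e mod int p * d"
      using cong_iff_dvd_diff cong_sym by blast
    then show "qcong p 1 a (of_nat (nat (n * e mod int p)))"
      unfolding key using p0 by simp
  next
    fix s assume s: "s < p \<and> qcong p 1 a (of_nat s)"
    have "int p dvd n - int s * d" using s key by blast
    then have "[int s * d = n] (mod int p)" using cong_iff_dvd_diff cong_sym by blast
    then have "[int s * d * e = n * e] (mod int p)" by (rule cong_scalar_right)
    moreover have "[int s * (d * e) = int s * 1] (mod int p)" using e by (rule cong_scalar_left)
    ultimately have "[int s = n * e] (mod int p)"
      by (simp add: cong_def mult.assoc)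
    then have "int s = n * e mod int p" using s by (simp add: cong_def)
    then show "s = nat (n * e mod int p)" by (metis nat_int)
  qed
qed

end

theory Submission
  imports Defs "HOL-Computational_Algebra.Formal_Power_Series" "HOL-Number_Theory.Residues"
begin

text \<open>
  Put \<open>r = \<langle>a\<rangle>\<^sub>p\<close> and \<open>x = a - r\<close>, a multiple of \<open>p\<close>. Stepping from \<open>x + j - 1\<close> to \<open>x + j\<close>
  changes the left-hand sum by \<open>(binom (x + j - 1) (p - 1) - 1) / (x + j)\<close>, and this binomial
  coefficient is \<open>x / j\<close> modulo \<open>p\<^sup>2\<close>. As the sum vanishes modulo \<open>p\<^sup>2\<close> at \<open>x\<close>, the left-hand side is
  \<open>x \<Sum> 1 / j\<^sup>2 - \<Sum> 1 / (x + j)\<close> with \<open>j\<close> from \<open>1\<close> to \<open>r\<close>. On the right, the difference equation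
  \<open>B\<^sub>n(y + 1) - B\<^sub>n(y) = n y\<^bsup>n-1\<^esup>\<close> and Euler's theorem turn the Bernoulli quotient into
  \<open>- \<Sum> 1 / (x + j)\<close> and \<open>B\<^bsub>p-2\<^esub>(-a)\<close> into \<open>2 \<Sum> 1 / j\<^sup>2\<close>; the value of the quotient at
  \<open>-x\<close> is negligible because every \<open>p B\<^sub>k\<close> is p-integral, \<open>B\<^sub>k\<close> itself is p-integral for
  \<open>k = p\<^sup>2(p - 1) - 2\<close>, and Bernoulli numbers of odd index above 1 vanish.
\<close>

section \<open>Bernoulli polynomials\<close>

text \<open>The exponential generating function t / (e^t - 1). As e^t - 1 has no constant term, the
  quotient is handled through the product identity that follows.\<close>

definition bernoulli_fps :: "rat fps" where
  "bernoulli_fps = Abs_fps (\<lambda>n. bernoulli n / fact n)"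

lemma bernoulli_fps_mult_exp_minus_1:
  "bernoulli_fps * (fps_exp 1 - 1) = fps_X"
proof (rule fps_ext)
  fix n
  have "fps_nth (bernoulli_fps * (fps_exp 1 - 1)) n
      = (\<Sum>k<n. bernoulli k / (fact k * fact (n - k)))"
    by (simp add: fps_mult_nth bernoulli_fps_def atLeast0AtMost mult.commute[of "fact (n - _)"]
        flip: lessThan_Suc_atMost)
  also have "\<dots> = (\<Sum>k<n. of_nat (n choose k) * bernoulli k) / fact n"
    unfolding sum_divide_distrib by (intro sum.cong) (simp_all add: binomial_fact)
  also have "\<dots> = fps_nth fps_X n"
  proof (cases "n \<ge> 2")
    case True
    then show ?thesis by (simp add: bernoulli_recurrence)
  next
    case False
    then have "n = 0 \<or> n = 1" by auto
    then show ?thesis by (auto simp: bernoulli_0)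
  qed
  finally show "fps_nth (bernoulli_fps * (fps_exp 1 - 1)) n = fps_nth fps_X n" .
qed

lemma bernpoly_fps:
  "fps_nth (bernoulli_fps * fps_exp x) n = bernpoly n x / fact n"
  unfolding fps_mult_nth bernpoly_def sum_divide_distrib atLeast0AtMost
  by (intro sum.cong) (simp_all add: bernoulli_fps_def binomial_fact)

text \<open>Since e^((x+1)t) - e^(xt) = (e^t - 1) e^(xt), the factor e^t - 1 cancels the denominator
  of \<open>bernoulli_fps\<close> and leaves t e^(xt).\<close>

lemma bernpoly_plus_1:
  "bernpoly n (x + 1) = bernpoly n x + of_nat n * x ^ (n - 1)"
proof -
  have "bernoulli_fps * fps_exp (x + 1)
      = bernoulli_fps * fps_exp x + bernoulli_fps * (fps_exp 1 - 1) * fps_exp x"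
    by (simp add: fps_exp_add_mult algebra_simps)
  then have "bernpoly n (x + 1) / fact n = bernpoly n x / fact n + fps_nth (fps_X * fps_exp x) n"
    by (metis bernoulli_fps_mult_exp_minus_1 bernpoly_fps fps_add_nth)
  then have "bernpoly n (x + 1) = bernpoly n x + fact n * fps_nth (fps_X * fps_exp x) n"
    by (simp add: field_simps)
  then show ?thesis
    by (cases n) simp_all
qed

lemma bernpoly_0: "bernpoly n 0 = bernoulli n"
proof -
  have "bernpoly n 0 = (\<Sum>k\<in>{n}. of_nat (n choose k) * bernoulli k * 0 ^ (n - k))"
    unfolding bernpoly_def by (rule sum.mono_neutral_right) auto
  then show ?thesis by simp
qed

lemma bernpoly_minus_eq_sum:
  "bernpoly n x = bernpoly n (x - of_nat r) + of_nat n * (\<Sum>j=1..r. (x - of_nat j) ^ (n - 1))"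
proof (induction r)
  case (Suc r)
  have "bernpoly n (x - of_nat r) = bernpoly n (x - of_nat (Suc r) + 1)"
    by (simp add: algebra_simps)
  also have "\<dots> = bernpoly n (x - of_nat (Suc r)) + of_nat n * (x - of_nat (Suc r)) ^ (n - 1)"
    by (rule bernpoly_plus_1)
  finally show ?case using Suc by (simp add: distrib_left)
qed simp

text \<open>The series G(t) = t / (e^t - 1) satisfies G(-t) = G(t) + t. Comparing coefficients of
  odd index other than 1 gives - B_n = B_n.\<close>

lemma bernoulli_odd:
  assumes "odd n" "n \<noteq> 1"
  shows "bernoulli n = 0"
proof -
  let ?G = "bernoulli_fps oo (- fps_X)"
  have "?G * (fps_exp (- 1) - 1) = - fps_X"
  proof -
    have "(bernoulli_fps * (fps_exp 1 - 1)) oo (- fps_X) = ?G * ((fps_exp 1 - 1) oo (- fps_X))"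
      by (rule fps_compose_mult_distrib) simp
    moreover have "(fps_exp 1 - 1) oo (- fps_X) = fps_exp (- 1 :: rat) - 1"
      by (simp add: fps_compose_sub_distrib fps_exp_compose_linear fps_compose_uminus')
        (simp add: fps_eq_iff fps_compose_uminus')
    ultimately show ?thesis
      by (simp add: bernoulli_fps_mult_exp_minus_1 fps_X_fps_compose_startby0)
  qed
  \<comment> \<open>Multiplication by e^t turns e^(-t) - 1 into -(e^t - 1), so both sides become
    multiples of the same series.\<close>
  then have "?G * (fps_exp (- 1) - 1) * fps_exp 1 = - fps_X * fps_exp 1" by simp
  moreover have "fps_exp (- 1) * fps_exp 1 = (1 :: rat fps)"
    by (simp flip: fps_exp_add_mult)
  then have "?G * (fps_exp 1 - 1) = - (?G * (fps_exp (- 1) - 1) * fps_exp 1)"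
    by (simp add: left_diff_distrib right_diff_distrib mult.assoc)
  ultimately have "?G * (fps_exp 1 - 1) = fps_X * fps_exp 1"
    by simp
  also have "\<dots> = (bernoulli_fps + fps_X) * (fps_exp 1 - 1)"
    using bernoulli_fps_mult_exp_minus_1 by (simp add: algebra_simps)
  finally have eq: "?G * (fps_exp 1 - 1) = (bernoulli_fps + fps_X) * (fps_exp 1 - 1)" .
  have "?G = bernoulli_fps + fps_X"
  proof -
    have "fps_nth (fps_exp 1 - 1 :: rat fps) 1 \<noteq> 0" by simp
    then have "(fps_exp 1 - 1 :: rat fps) \<noteq> 0" by (metis fps_zero_nth)
    with eq show ?thesis by simp
  qed
  then have "fps_nth ?G n = fps_nth (bernoulli_fps + fps_X) n" by simp
  then show ?thesis
    using assms by (simp add: fps_compose_uminus' bernoulli_fps_def)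
qed


text \<open>Absorption, k binom(n, k) = n binom(n-1, k-1), extracts the factor n. Division by n =
  \<open>N\<close>, itself divisible by p^2, then leaves only the denominators k.\<close>

lemma bernpoly_minus_bernoulli:
  assumes "0 < n"
  shows "bernpoly n x - bernoulli n
    = of_nat n * (\<Sum>k=1..n. of_nat ((n - 1) choose (k - 1)) * bernoulli (n - k) * x ^ k / of_nat k)"
proof -
  have "bernpoly n x = (\<Sum>k\<le>n. of_nat (n choose (n - k)) * bernoulli (n - k) * x ^ (n - (n - k)))"
    unfolding bernpoly_def atMost_atLeast0 by (subst sum.atLeastAtMost_rev) simp
  also have "\<dots> = (\<Sum>k\<le>n. of_nat (n choose k) * bernoulli (n - k) * x ^ k)"
    by (intro sum.cong) (simp_all add: binomial_symmetric[symmetric])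
  also have "\<dots> = bernoulli n + (\<Sum>k=1..n. of_nat (n choose k) * bernoulli (n - k) * x ^ k)"
    by (simp add: atMost_atLeast0 sum.atLeast_Suc_atMost)
  also have "(\<Sum>k=1..n. of_nat (n choose k) * bernoulli (n - k) * x ^ k)
    = of_nat n * (\<Sum>k=1..n. of_nat ((n - 1) choose (k - 1)) * bernoulli (n - k) * x ^ k / of_nat k)"
    unfolding sum_distrib_left
  proof (intro sum.cong refl)
    fix k assume k: "k \<in> {1..n}"
    then have "k * (n choose k) = n * ((n - 1) choose (k - 1))"
      by (intro times_binomial_minus1_eq) simp
    then have "(of_nat k * of_nat (n choose k) :: rat) = of_nat n * of_nat ((n - 1) choose (k - 1))"
      by (metis of_nat_mult)
    then show "of_nat (n choose k) * bernoulli (n - k) * x ^ k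
        = of_nat n * (of_nat ((n - 1) choose (k - 1)) * bernoulli (n - k) * x ^ k / of_nat k)"
      using k by (simp add: field_simps)
  qed
  finally show ?thesis by simp
qed

text \<open>Faulhaber's formula, by telescoping the difference equation from 0 to m. With m = p it
  links p B_n to a power sum over the residues.\<close>

lemma sum_powers:
  assumes "0 < n"
  shows "(\<Sum>i<m. of_nat i ^ (n - 1))
    = (\<Sum>k=1..n. of_nat ((n - 1) choose (k - 1)) * bernoulli (n - k) * of_nat m ^ k / of_nat k)"
proof -
  have "of_nat n * (\<Sum>i<m. of_nat i ^ (n - 1)) = bernpoly n (of_nat m) - bernoulli n"
  proof (induction m)
    case (Suc m)
    then show ?case using bernpoly_plus_1[of n "of_nat m"] by (simp add: algebra_simps)
  qed (simp add: bernpoly_0)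
  then show ?thesis using assms bernpoly_minus_bernoulli[of n "of_nat m"] by simp
qed

section \<open>Differences of the harmonic binomial sum\<close>

text \<open>The left-hand side of the theorem as a function of y, with m = p - 1 there. At y = -1 it
  is the m-th harmonic number.\<close>

definition harmonic_gbinomial :: "nat \<Rightarrow> rat \<Rightarrow> rat" where
  "harmonic_gbinomial m y = (\<Sum>k=1..m. (-1) ^ k / of_nat k * (y gchoose k))"

text \<open>By Pascal's rule each term changes by a multiple of binom(y, k-1) / k, which is
  binom(y+1, k) / (y+1). The alternating sum of binom(y+1, k) over k from 0 to m collapses to
  binom(y, m) for even m; the - 1 removes its term k = 0.\<close>

lemma harmonic_gbinomial_plus_1:
  assumes "y + 1 \<noteq> 0" and "even m"
  shows "harmonic_gbinomial m (y + 1) = harmonic_gbinomial m y + ((y gchoose m) - 1) / (y + 1)"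
proof -
  have "harmonic_gbinomial m (y + 1) - harmonic_gbinomial m y
      = (\<Sum>k=1..m. (-1) ^ k * (y + 1 gchoose k) / (y + 1))"
    unfolding harmonic_gbinomial_def sum_subtractf[symmetric]
  proof (intro sum.cong refl)
    fix k assume "k \<in> {1..m}"
    then obtain l where k: "k = Suc l" by (cases k) auto
    have "(y + 1 gchoose k) - (y gchoose k) = (y gchoose l)"
      by (simp add: k gbinomial_Suc_Suc)
    then have "(-1) ^ k / of_nat k * (y + 1 gchoose k) - (-1) ^ k / of_nat k * (y gchoose k)
        = (-1) ^ k / of_nat k * (y gchoose l)"
      by (metis right_diff_distrib)
    moreover have "(y + 1 gchoose k) = (y + 1) / of_nat k * (y gchoose l)"
      unfolding k by (rule gbinomial_factors)
    ultimately show "(-1) ^ k / of_nat k * (y + 1 gchoose k) - (-1) ^ k / of_nat k * (y gchoose k)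
        = (-1) ^ k * (y + 1 gchoose k) / (y + 1)"
      using assms(1) by simp
  qed
  also have "\<dots> = ((\<Sum>k\<le>m. (y + 1 gchoose k) * (-1) ^ k) - 1) / (y + 1)"
    by (simp add: sum_divide_distrib[symmetric] atMost_atLeast0 sum.atLeast_Suc_atMost mult.commute)
  also have "(\<Sum>k\<le>m. (y + 1 gchoose k) * (-1) ^ k) = y gchoose m"
    using assms(2) by (simp add: gbinomial_sum_lower_neg)
  finally show ?thesis by simp
qed

section \<open>Congruences between p-integral rationals\<close>

context
  fixes p :: nat
  assumes p: "prime p"
begin

section \<open>The ring of p-integral rationals\<close>

lemma Zloc_of_int [simp]: "of_int n \<in> Zloc p"
proof -
  have "\<not> int p dvd 1" using p by (auto dest: prime_gt_1_nat)
  then show ?thesis unfolding Zloc_iff by (intro exI[of _ n] exI[of _ 1]) simp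
qed

lemma Zloc_of_nat [simp]: "of_nat n \<in> Zloc p"
  using Zloc_of_int[of "int n"] by simp

lemma Zloc_0 [simp]: "0 \<in> Zloc p" and Zloc_1 [simp]: "1 \<in> Zloc p"
  using Zloc_of_int[of 0] Zloc_of_int[of 1] by simp_all

lemma not_dvd_mult: "\<not> int p dvd m \<Longrightarrow> \<not> int p dvd n \<Longrightarrow> \<not> int p dvd m * n"
  using p by (simp add: prime_dvd_mult_iff)

lemma Zloc_add [simp]: "x \<in> Zloc p \<Longrightarrow> y \<in> Zloc p \<Longrightarrow> x + y \<in> Zloc p"
proof -
  assume "x \<in> Zloc p" "y \<in> Zloc p"
  then obtain m d n e where *: "\<not> int p dvd d" "x = of_int m / of_int d"
    "\<not> int p dvd e" "y = of_int n / of_int e"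
    unfolding Zloc_iff by blast
  moreover from this have "d \<noteq> 0" "e \<noteq> 0" by auto
  ultimately have "x + y = of_int (m * e + n * d) / of_int (d * e)"
    by (simp add: field_simps)
  with not_dvd_mult[OF *(1,3)] show ?thesis unfolding Zloc_iff by blast
qed

lemma Zloc_mult [simp]: "x \<in> Zloc p \<Longrightarrow> y \<in> Zloc p \<Longrightarrow> x * y \<in> Zloc p"
proof -
  assume "x \<in> Zloc p" "y \<in> Zloc p"
  then obtain m d n e where *: "\<not> int p dvd d" "x = of_int m / of_int d"
    "\<not> int p dvd e" "y = of_int n / of_int e"
    unfolding Zloc_iff by blast
  then have "x * y = of_int (m * n) / of_int (d * e)" by simp
  with not_dvd_mult[OF *(1,3)] show ?thesis unfolding Zloc_iff by blast
qed

lemma Zloc_minus [simp]: "x \<in> Zloc p \<Longrightarrow> - x \<in> Zloc p"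
  using Zloc_mult[OF Zloc_of_int[of "-1"], of x] by (simp del: Zloc_mult)

lemma Zloc_diff [simp]: "x \<in> Zloc p \<Longrightarrow> y \<in> Zloc p \<Longrightarrow> x - y \<in> Zloc p"
  using Zloc_add[of x "- y"] by simp

lemma Zloc_power [simp]: "x \<in> Zloc p \<Longrightarrow> x ^ n \<in> Zloc p"
  by (induction n) simp_all

lemma Zloc_sum: "(\<And>i. i \<in> A \<Longrightarrow> f i \<in> Zloc p) \<Longrightarrow> sum f A \<in> Zloc p"
  by (induction A rule: infinite_finite_induct) simp_all

lemma Zloc_divide_of_nat:
  assumes "x \<in> Zloc p" "\<not> p dvd n"
  shows "x / of_nat n \<in> Zloc p"
proof -
  have "1 / of_nat n \<in> Zloc p"
    unfolding Zloc_iff using assms(2) by (intro exI[of _ 1] exI[of _ "int n"]) simp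
  then show ?thesis using Zloc_mult[OF assms(1), of "1 / of_nat n"] by simp
qed

section \<open>Arithmetic of congruences modulo powers of p\<close>

lemma qcong_iff: "qcong p m x y \<longleftrightarrow> (\<exists>z\<in>Zloc p. x = y + of_nat p ^ m * z)"
proof -
  have [simp]: "p \<noteq> 0" using p by auto
  have "x = y + of_nat p ^ m * z \<longleftrightarrow> (x - y) / of_nat p ^ m = z" for z
    by (auto simp: field_simps)
  then show ?thesis unfolding qcong_def by auto
qed

lemma qcongI: "z \<in> Zloc p \<Longrightarrow> x = y + of_nat p ^ m * z \<Longrightarrow> qcong p m x y"
  unfolding qcong_iff by blast

lemma qcong_refl [simp]: "qcong p m x x"
  by (rule qcongI[of 0]) simp_all

lemma qcong_sym: "qcong p m x y \<Longrightarrow> qcong p m y x"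
proof -
  assume "qcong p m x y"
  then obtain z where "z \<in> Zloc p" "x = y + of_nat p ^ m * z"
    unfolding qcong_iff by blast
  then show ?thesis by (intro qcongI[of "- z"]) simp_all
qed

lemma qcong_add: "qcong p m x y \<Longrightarrow> qcong p m x' y' \<Longrightarrow> qcong p m (x + x') (y + y')"
proof -
  assume "qcong p m x y" "qcong p m x' y'"
  then obtain z z' where "z \<in> Zloc p" "x = y + of_nat p ^ m * z"
    "z' \<in> Zloc p" "x' = y' + of_nat p ^ m * z'"
    unfolding qcong_iff by blast
  then show ?thesis by (intro qcongI[of "z + z'"]) (simp_all add: algebra_simps)
qed

lemma qcong_trans [trans]: "qcong p m x y \<Longrightarrow> qcong p m y z \<Longrightarrow> qcong p m x z"
  using qcong_add[of m x y y z] unfolding qcong_def by simp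

lemma qcong_cmult: "z \<in> Zloc p \<Longrightarrow> qcong p m x y \<Longrightarrow> qcong p m (z * x) (z * y)"
proof -
  assume "z \<in> Zloc p" "qcong p m x y"
  then obtain w where "w \<in> Zloc p" "x = y + of_nat p ^ m * w"
    unfolding qcong_iff by blast
  with \<open>z \<in> Zloc p\<close> show ?thesis by (intro qcongI[of "z * w"]) (simp_all add: algebra_simps)
qed

lemma qcong_minus: "qcong p m x y \<Longrightarrow> qcong p m (- x) (- y)"
  using qcong_cmult[of "- 1" m x y] by simp

lemma qcong_diff: "qcong p m x y \<Longrightarrow> qcong p m x' y' \<Longrightarrow> qcong p m (x - x') (y - y')"
  using qcong_add[of m x y "- x'" "- y'"] qcong_minus[of m x' y'] by simp

text \<open>From x x' - y y' = x (x' - y') + y' (x - y). A congruence does not make its sides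
  p-integral, so this is assumed of the two cofactors.\<close>

lemma qcong_mult:
  assumes "qcong p m x y" "qcong p m x' y'" "x \<in> Zloc p" "y' \<in> Zloc p"
  shows "qcong p m (x * x') (y * y')"
  using qcong_trans[OF qcong_cmult[OF assms(3,2)]] qcong_cmult[OF assms(4,1)]
  by (simp add: mult.commute)

lemma qcong_power:
  assumes "qcong p m x y" "x \<in> Zloc p" "y \<in> Zloc p"
  shows "qcong p m (x ^ n) (y ^ n)"
  by (induction n) (simp_all add: qcong_mult assms)

lemma qcong_sum: "(\<And>i. i \<in> A \<Longrightarrow> qcong p m (f i) (g i)) \<Longrightarrow> qcong p m (sum f A) (sum g A)"
  by (induction A rule: infinite_finite_induct) (simp_all add: qcong_add)

lemma qcong_0_mult: "qcong p m x 0 \<Longrightarrow> qcong p n y 0 \<Longrightarrow> qcong p (m + n) (x * y) 0"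
proof -
  assume "qcong p m x 0" "qcong p n y 0"
  then obtain z w where "z \<in> Zloc p" "x = of_nat p ^ m * z" "w \<in> Zloc p" "y = of_nat p ^ n * w"
    unfolding qcong_iff by auto
  then show ?thesis by (intro qcongI[of "z * w"]) (simp_all add: power_add)
qed

text \<open>Used with m = n = 1: whatever is multiplied by a multiple of p has to be known only
  modulo p to determine the product modulo p^2.\<close>

lemma qcong_0_mult_cong:
  assumes "qcong p m x 0" "qcong p n y z"
  shows "qcong p (m + n) (x * y) (x * z)"
  using qcong_0_mult[OF assms(1), of n "y - z"] assms(2)
  by (simp add: qcong_def algebra_simps)

lemma qcong_p_mult_iff: "qcong p (Suc m) (of_nat p * x) (of_nat p * y) \<longleftrightarrow> qcong p m x y"
proof -
  have "p \<noteq> 0" using p by auto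
  then show ?thesis by (simp add: qcong_def flip: right_diff_distrib)
qed

lemma qcong_le: "qcong p m x y \<Longrightarrow> n \<le> m \<Longrightarrow> qcong p n x y"
proof -
  assume "qcong p m x y" and le: "n \<le> m"
  then obtain z where "z \<in> Zloc p" "x = y + of_nat p ^ m * z"
    unfolding qcong_iff by blast
  then show ?thesis using le
    by (intro qcongI[of "of_nat p ^ (m - n) * z"]) (simp_all flip: mult.assoc power_add)
qed

lemma qcong_Zloc: "qcong p m x y \<Longrightarrow> y \<in> Zloc p \<Longrightarrow> x \<in> Zloc p"
  unfolding qcong_iff by auto

lemma qcong_0_iff_Zloc: "qcong p 0 x 0 \<longleftrightarrow> x \<in> Zloc p"
  by (simp add: qcong_def)

text \<open>A rational with nonzero residue is a unit: if p divided its numerator, j and 0 would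
  both be residues of j, against \<open>ex1_qresidue\<close>. The last claim carries Fermat's
  theorem from j to u.\<close>

lemma
  assumes u: "qcong p 1 u (of_nat j)" and j: "0 < j" "j < p"
  shows unit_nonzero: "u \<noteq> 0"
    and Zloc_divide_unit: "x \<in> Zloc p \<Longrightarrow> x / u \<in> Zloc p"
    and unit_power_totient: "qcong p 1 (u ^ (p - 1)) 1"
proof -
  have nd: "\<not> p dvd j" using j by (auto dest: dvd_imp_le)
  have uZ: "u \<in> Zloc p" using qcong_Zloc[OF u] by simp
  obtain n d where n: "\<not> int p dvd d" "u = of_int n / of_int d"
    using uZ unfolding Zloc_iff by blast
  have "d \<noteq> 0" using n by auto
  have "\<not> int p dvd n"
  proof
    assume "int p dvd n"
    then obtain m where "n = int p * m" by blast
    then have "qcong p 1 u 0"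
      using n \<open>d \<noteq> 0\<close>
      by (intro qcongI[of "of_int m / of_int d"]) (auto simp: Zloc_iff)
    then have "qcong p 1 (of_nat j) 0" using u qcong_sym qcong_trans by blast
    then have "qcong p 1 (of_nat j) (of_nat 0)" by simp
    moreover have "qcong p 1 (of_nat j) (of_nat j)" by simp
    ultimately show False
      using ex1_qresidue[OF p Zloc_of_nat[of j]] j by (metis neq0_conv order_less_trans)
  qed
  then have "n \<noteq> 0" by auto
  show "u \<noteq> 0" using n \<open>n \<noteq> 0\<close> \<open>d \<noteq> 0\<close> by simp
  have "1 / u = of_int d / of_int n" using n by simp
  then have "1 / u \<in> Zloc p" unfolding Zloc_iff using \<open>\<not> int p dvd n\<close> by blast
  then show "x \<in> Zloc p \<Longrightarrow> x / u \<in> Zloc p"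
    using Zloc_mult[of x "1 / u"] by simp
  have "int p dvd int (j ^ (p - 1)) - 1"
    using fermat_theorem[OF p nd] by (metis cong_iff_dvd_diff cong_int_iff of_nat_1)
  then obtain k where k: "int (j ^ (p - 1)) - 1 = int p * k" by blast
  have "(of_nat j :: rat) ^ (p - 1) = of_int (int (j ^ (p - 1)))" by simp
  also have "\<dots> = of_int (1 + int p * k)" using k by (simp only: algebra_simps)
  finally have "(of_nat j :: rat) ^ (p - 1) = 1 + of_nat p ^ 1 * of_int k" by simp
  then have "qcong p 1 ((of_nat j) ^ (p - 1)) 1" by (rule qcongI[rotated]) simp
  then show "qcong p 1 (u ^ (p - 1)) 1"
    using qcong_trans[OF qcong_power[OF u uZ Zloc_of_nat]] by blast
qed

text \<open>In x^p - 1 = (x - 1)(1 + x + ... + x^(p-1)) the second factor is congruent to p, hence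
  to 0, modulo p, which gains one power of p.\<close>

lemma qcong_power_p_1:
  assumes "qcong p m x 1" "0 < m"
  shows "qcong p (Suc m) (x ^ p) 1"
proof -
  have xZ: "x \<in> Zloc p" using assms(1) qcong_Zloc by simp
  have "qcong p 1 x 1" using assms qcong_le by fastforce
  then have "qcong p 1 (\<Sum>i<p. x ^ i) (\<Sum>i<p. 1)"
    using qcong_power[of 1 x 1] xZ by (intro qcong_sum) simp
  moreover have "qcong p 1 (of_nat p) 0" by (rule qcongI[of 1]) simp_all
  ultimately have "qcong p 1 (\<Sum>i<p. x ^ i) 0" using qcong_trans by simp
  moreover have "qcong p m (x - 1) 0" using assms(1) by (simp add: qcong_def)
  ultimately have "qcong p (m + 1) ((x - 1) * (\<Sum>i<p. x ^ i)) 0"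
    by (intro qcong_0_mult)
  then show ?thesis by (simp add: qcong_def flip: power_diff_1_eq)
qed

lemma qcong_divide_unit:
  assumes "qcong p m (u * x) y" "qcong p 1 u (of_nat j)" "0 < j" "j < p"
  shows "qcong p m x (y / u)"
  using qcong_cmult[OF Zloc_divide_unit[OF assms(2-4) Zloc_1] assms(1)]
    unit_nonzero[OF assms(2-4)] by simp

section \<open>Bernoulli numbers modulo a prime\<close>

context
  fixes N :: nat
  assumes p3: "p > 3" and N_def: "N = p\<^sup>2 * (p - 1)"
begin

text \<open>The p-adic valuation v of k is so small against k that dividing p^k by k still leaves
  p^c.\<close>

lemma qcong_p_power_divide:
  assumes "c \<le> k" "c \<le> 3" "0 < k"
  shows "qcong p c (of_nat p ^ k / of_nat k) 0"
proof -
  obtain u where u: "k = p ^ multiplicity p k * u" "\<not> p dvd u"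
    using multiplicity_decompose'[of k p] assms(3) p by (auto simp: prime_nat_iff)
  define v where "v = multiplicity p k"
  have "v + c \<le> k"
  proof (cases "v = 0")
    case False
    \<comment> \<open>For v > 0 this bound gives k >= p^v >= 4^v >= 1 + 3 v >= v + 3, and c is at
      most 3.\<close>
    have "1 + 3 * v \<le> 4 ^ v" by (induction v) auto
    also have "\<dots> \<le> p ^ v" using p3 by (intro power_mono) auto
    also have "\<dots> \<le> k" using assms(3) by (simp add: v_def dvd_imp_le multiplicity_dvd)
    finally show ?thesis using False assms(2) by simp
  qed (use assms in simp)
  then have "k = v + c + (k - (v + c))" by simp
  then have "(of_nat p ^ k :: rat) = of_nat p ^ v * of_nat p ^ c * of_nat p ^ (k - (v + c))"
    by (metis power_add)
  moreover have "(of_nat k :: rat) = of_nat p ^ v * of_nat u"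
    using u(1) unfolding v_def by (metis of_nat_mult of_nat_power)
  ultimately have "of_nat p ^ k / of_nat k = 0 + of_nat p ^ c * (of_nat p ^ (k - (v + c)) / of_nat u :: rat)"
    using p3 by simp
  then show ?thesis
    by (rule qcongI[rotated]) (use u in \<open>simp add: Zloc_divide_of_nat\<close>)
qed

text \<open>A weak form of the von Staudt-Clausen theorem. Faulhaber's formula for the sum of i^n
  over i < p has p B_n as its term k = 1. For k >= 2 the factor p^k / k contains p^2: one p makes
  the earlier Bernoulli number p-integral by induction, the other makes the term vanish modulo
  p.\<close>

lemma p_bernoulli:
  "of_nat p * bernoulli n \<in> Zloc p \<and>
   qcong p 1 (of_nat p * bernoulli n) (\<Sum>i<p. of_nat i ^ n)"
proof (induction n rule: less_induct)
  case (less n)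
  define f :: "nat \<Rightarrow> rat"
    where "f k = of_nat (n choose (k - 1)) * bernoulli (Suc n - k) * of_nat p ^ k / of_nat k" for k
  have "(\<Sum>i<p. of_nat i ^ n) = sum f {1..Suc n}"
    using sum_powers[of "Suc n" p] by (simp add: f_def)
  also have "\<dots> = of_nat p * bernoulli n + sum f {2..Suc n}"
    by (subst sum.atLeast_Suc_atMost) (simp_all add: f_def numeral_2_eq_2)
  finally have eq: "(\<Sum>i<p. of_nat i ^ n) = of_nat p * bernoulli n + sum f {2..Suc n}" .
  have "qcong p 1 (f k) 0" if k: "k \<in> {2..Suc n}" for k
  proof -
    obtain w where w: "w \<in> Zloc p" "of_nat p ^ k / of_nat k = of_nat p ^ 2 * w"
      using qcong_p_power_divide[of 2 k] k unfolding qcong_iff by auto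
    have "f k = of_nat (n choose (k - 1)) * bernoulli (Suc n - k) * (of_nat p ^ k / of_nat k)"
      by (simp add: f_def)
    also have "\<dots> = 0 + of_nat p ^ 1 *
        (of_nat (n choose (k - 1)) * (of_nat p * bernoulli (Suc n - k)) * w)"
      unfolding w(2) by (simp add: power2_eq_square)
    finally have eq: "f k = 0 + of_nat p ^ 1 *
        (of_nat (n choose (k - 1)) * (of_nat p * bernoulli (Suc n - k)) * w)" .
    have "Suc n - k < n" using k by auto
    then have "of_nat p * bernoulli (Suc n - k) \<in> Zloc p" using less.IH by blast
    then show ?thesis by (intro qcongI[OF _ eq]) (use w in simp)
  qed
  then have "qcong p 1 (sum f {2..Suc n}) (\<Sum>k\<in>{2..Suc n}. 0)" by (rule qcong_sum)
  then have "qcong p 1 ((\<Sum>i<p. of_nat i ^ n) - sum f {2..Suc n}) ((\<Sum>i<p. of_nat i ^ n) - 0)"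
    by (intro qcong_diff) simp_all
  then have "qcong p 1 (of_nat p * bernoulli n) (\<Sum>i<p. of_nat i ^ n)" using eq by simp
  moreover have "(\<Sum>i<p. of_nat i ^ n) \<in> Zloc p" by (intro Zloc_sum) simp
  ultimately show ?case using qcong_Zloc by blast
qed

lemma bernoulli_Zloc:
  assumes "qcong p 1 (\<Sum>i<p. of_nat i ^ n) 0"
  shows "bernoulli n \<in> Zloc p"
proof -
  have "qcong p 1 (of_nat p * bernoulli n) (of_nat p * 0)"
    using qcong_trans[OF conjunct2[OF p_bernoulli] assms] by simp
  then show ?thesis
    using qcong_p_mult_iff[of 0 "bernoulli n" 0] by (simp add: qcong_0_iff_Zloc)
qed

text \<open>The recurrence up to this index divides only by integers below p.\<close>

lemma bernoulli_Zloc_small: "Suc n < p \<Longrightarrow> bernoulli n \<in> Zloc p"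
proof (induction n rule: less_induct)
  case (less n)
  have "\<not> p dvd Suc n" using less.prems by (auto dest: dvd_imp_le)
  moreover have "(\<Sum>k<n. of_nat (Suc n choose k) * bernoulli k) \<in> Zloc p"
    using less by (intro Zloc_sum Zloc_mult) auto
  ultimately show ?case
    using Zloc_divide_of_nat by (subst bernoulli.simps) (simp del: of_nat_Suc)
qed

text \<open>\<open>p_bernoulli\<close> read backwards: p-integrality of B_(p-3) makes p B_(p-3), and
  so the power sum, vanish modulo p.\<close>

lemma sum_powers_p_minus_3: "qcong p 1 (\<Sum>i<p. of_nat i ^ (p - 3)) 0"
proof -
  have "bernoulli (p - 3) \<in> Zloc p" using p3 by (intro bernoulli_Zloc_small) simp
  then have "qcong p 1 (of_nat p * bernoulli (p - 3)) 0"
    by (rule qcongI) simp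
  then show ?thesis using p_bernoulli qcong_sym qcong_trans by blast
qed

lemma N_eq: "N = (p - 1) * p * p"
  by (simp add: N_def power2_eq_square)

lemma p_odd: "odd p"
  using p p3 prime_odd_nat by simp

lemma N_even: "even N"
  using p_odd by (simp add: N_def)

lemma N_gt: "N > p"
proof -
  have "1 < p * (p - 1)" using p3 by (intro less_1_mult) auto
  then have "p * 1 < p * (p * (p - 1))" using p3 by (intro mult_strict_left_mono) auto
  then show ?thesis by (simp add: N_def power2_eq_square)
qed

section \<open>Powers and inverses of a unit modulo p and modulo p^2\<close>

context
  fixes u :: rat and j :: nat
  assumes u: "qcong p 1 u (of_nat j)" and j: "0 < j" "j < p"
begin

lemma unit_inverse: "qcong p 1 (1 / u) (1 / of_nat j)"
proof -
  have "qcong p 1 (of_nat j * (1 / u)) (u * (1 / u))"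
    using qcong_cmult[OF Zloc_divide_unit[OF u j Zloc_1] qcong_sym[OF u]] by (simp add: mult.commute)
  then have "qcong p 1 (of_nat j * (1 / u)) 1" using unit_nonzero[OF u j] by simp
  then show ?thesis by (rule qcong_divide_unit[OF _ qcong_refl j])
qed

text \<open>Fermat's congruence raised to the p-th power holds modulo p^2, and a further p-th power
  reaches the exponent \<open>N\<close>. Dividing u^N by u gives the inverse.\<close>

lemma unit_power_N: "qcong p 2 (u ^ (N - 1)) (1 / u)"
proof -
  have "qcong p 2 (((u ^ (p - 1)) ^ p)) 1"
    using qcong_power_p_1[OF unit_power_totient[OF u j]] by (simp add: numeral_2_eq_2)
  then have "qcong p 2 (((u ^ (p - 1)) ^ p) ^ p) (1 ^ p)"
    using qcong_Zloc[OF u] by (intro qcong_power) auto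
  then have "qcong p 2 (u ^ N) 1" by (simp add: N_eq power_mult)
  moreover have "u ^ N = u * u ^ (N - 1)" using N_gt by (cases N) auto
  ultimately show ?thesis using qcong_divide_unit[OF _ u j] by simp
qed

lemma unit_power_p_minus_3: "qcong p 1 (u ^ (p - 3)) (1 / of_nat j ^ 2)"
proof -
  have "u ^ (p - 1) = u * (u * u ^ (p - 3))"
    using p3 by (simp flip: power_Suc add: numeral_eq_Suc Suc_diff_Suc)
  then have "qcong p 1 (u * (u * u ^ (p - 3))) 1"
    using unit_power_totient[OF u j] by simp
  from qcong_divide_unit[OF qcong_divide_unit[OF this u j] u j]
  have "qcong p 1 (u ^ (p - 3)) (1 / u * (1 / u))" by simp
  also have "qcong p 1 (1 / u * (1 / u)) (1 / of_nat j * (1 / of_nat j))"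
    by (intro qcong_mult unit_inverse Zloc_divide_unit[OF u j] Zloc_divide_unit[OF qcong_refl j]) auto
  finally show ?thesis by (simp add: power2_eq_square)
qed

end

lemma sum_inverse_squares: "qcong p 1 (\<Sum>j=1..p-1. 1 / of_nat j ^ 2) 0"
proof -
  have "qcong p 1 (\<Sum>j=1..p-1. of_nat j ^ (p - 3)) (\<Sum>j=1..p-1. 1 / of_nat j ^ 2)"
    using p3 by (intro qcong_sum unit_power_p_minus_3) auto
  \<comment> \<open>The term i = 0 drops out because p - 3 is positive.\<close>
  moreover have "(\<Sum>i<p. of_nat i ^ (p - 3)) = (\<Sum>j=1..p-1. of_nat j ^ (p - 3) :: rat)"
    using p3 by (intro sum.mono_neutral_right) (auto simp: Suc_le_eq)
  ultimately show ?thesis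
    using sum_powers_p_minus_3 qcong_sym qcong_trans by metis
qed

text \<open>Modulo p - 1 the exponents N - 2 and p - 3 agree, so by Fermat their power sums agree
  modulo p.\<close>

lemma bernoulli_N_minus_2: "bernoulli (N - 2) \<in> Zloc p"
proof (rule bernoulli_Zloc)
  have N2: "N - 2 = (p - 1) * (p * p - 1) + (p - 3)"
  proof -
    have "N = (p - 1) * ((p * p - 1) + 1)" using p3 by (simp add: N_eq mult.assoc)
    also have "\<dots> = (p - 1) * (p * p - 1) + (p - 1)" by (simp only: distrib_left mult_1_right)
    finally show ?thesis using p3 by linarith
  qed
  have "qcong p 1 (of_nat i ^ (N - 2)) (of_nat i ^ (p - 3))" if "i < p" for i
  proof (cases "i = 0")
    case True
    then show ?thesis using p3 N_gt by (simp add: zero_power)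
  next
    case False
    with that have "qcong p 1 (of_nat i ^ (p - 1)) 1"
      using unit_power_totient[OF qcong_refl] by simp
    then have "qcong p 1 ((of_nat i ^ (p - 1)) ^ (p * p - 1)) (1 ^ (p * p - 1))"
      by (intro qcong_power) auto
    from qcong_cmult[OF _ this, of "of_nat i ^ (p - 3)"]
    show ?thesis by (simp add: N2 power_add power_mult mult.commute)
  qed
  then have "qcong p 1 (\<Sum>i<p. of_nat i ^ (N - 2)) (\<Sum>i<p. of_nat i ^ (p - 3))"
    by (intro qcong_sum) simp
  then show "qcong p 1 (\<Sum>i<p. of_nat i ^ (N - 2)) 0"
    using sum_powers_p_minus_3 qcong_trans by blast
qed

text \<open>In the expansion by powers of x, with N cancelled, the term k = 1 contains B_(N-1) = 0.
  The term k = 2 has p^2 from x^2 and a p-integral B_(N-2). For k >= 3, p^k / k supplies p^3, of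
  which one p is spent on B_(N-k).\<close>

lemma bernpoly_N_quotient:
  assumes x: "qcong p 1 x 0"
  shows "qcong p 2 ((bernpoly N x - bernoulli N) / of_nat N) 0"
proof -
  define f where "f k = of_nat ((N - 1) choose (k - 1)) * bernoulli (N - k) * x ^ k / of_nat k" for k
  obtain z where z: "z \<in> Zloc p" "x = of_nat p * z"
    using x unfolding qcong_iff by auto
  have "qcong p 2 (f k) 0" if k: "k \<in> {1..N}" for k
  proof -
    consider "k = 1" | "k = 2" | "k \<ge> 3" using k by fastforce
    then show ?thesis
    proof cases
      case 1
      have "bernoulli (N - 1) = 0"
        using N_even N_gt p3 by (intro bernoulli_odd) auto
      then show ?thesis using 1 by (simp add: f_def)
    next
      case 2
      have eq: "f k = 0 + of_nat p ^ 2 * (of_nat (N - 1) * bernoulli (N - 2) * z ^ 2 / of_nat 2)"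
        by (simp add: 2 f_def z power_mult_distrib)
      have "\<not> p dvd 2" using p3 by (auto dest: dvd_imp_le)
      then show ?thesis
        using z bernoulli_N_minus_2 by (intro qcongI[OF _ eq] Zloc_divide_of_nat) auto
    next
      case 3
      obtain w where w: "w \<in> Zloc p" "of_nat p ^ k / of_nat k = of_nat p ^ 3 * w"
        using qcong_p_power_divide[of 3 k] 3 unfolding qcong_iff by auto
      have "f k = of_nat ((N - 1) choose (k - 1)) * bernoulli (N - k) * z ^ k * (of_nat p ^ k / of_nat k)"
        by (simp add: f_def z power_mult_distrib)
      also have "\<dots> = 0 + of_nat p ^ 2 *
          (of_nat ((N - 1) choose (k - 1)) * (of_nat p * bernoulli (N - k)) * z ^ k * w)"
        unfolding w(2) by (simp add: power2_eq_square power3_eq_cube)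
      finally have eq: "f k = 0 + of_nat p ^ 2 *
          (of_nat ((N - 1) choose (k - 1)) * (of_nat p * bernoulli (N - k)) * z ^ k * w)" .
      then show ?thesis
        using z w p_bernoulli[of "N - k"] by (intro qcongI[OF _ eq]) simp
    qed
  qed
  then have "qcong p 2 (sum f {1..N}) (\<Sum>k\<in>{1..N}. 0)" by (rule qcong_sum)
  then show ?thesis
    using bernpoly_minus_bernoulli[of N x] N_gt by (simp add: f_def)
qed

text \<open>For these n all coefficients of the polynomial are p-integral, so x may be replaced by 0
  modulo p.\<close>

lemma bernpoly_cong_bernoulli:
  assumes x: "qcong p 1 x 0" and n: "Suc n < p"
  shows "qcong p 1 (bernpoly n x) (bernoulli n)"
proof -
  have "qcong p 1 (bernpoly n x) (bernpoly n 0)"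
    unfolding bernpoly_def using n x qcong_Zloc[OF x]
    by (intro qcong_sum qcong_cmult qcong_power Zloc_mult bernoulli_Zloc_small) auto
  then show ?thesis by (simp add: bernpoly_0)
qed

section \<open>Evaluation modulo the square of the prime\<close>

context
  fixes x :: rat
  assumes x: "qcong p 1 x 0"
begin

lemma multiple_of_p_Zloc [simp]: "x \<in> Zloc p"
  using qcong_Zloc[OF x] by simp

lemma multiple_of_p_plus: "qcong p 1 (x + of_nat j) (of_nat j)"
  using qcong_add[OF x qcong_refl] by simp

text \<open>Modulo p this is binom(-1, k) = (-1)^k; the denominators k! are units because k <
  p.\<close>

lemma gbinomial_minus_1_cong: "k < p \<Longrightarrow> qcong p 1 ((x - 1) gchoose k) ((- 1) ^ k)"
proof (induction k)
  case (Suc k)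
  have "of_nat (Suc k) * ((x - 1) gchoose Suc k) = (x - of_nat (Suc k)) * ((x - 1) gchoose k)"
    using gbinomial_mult_1[of "x - 1" k] by (simp add: algebra_simps)
  moreover have "qcong p 1 (x - of_nat (Suc k)) (0 - of_nat (Suc k))"
    using qcong_diff[OF x qcong_refl] .
  ultimately have "qcong p 1 (of_nat (Suc k) * ((x - 1) gchoose Suc k))
      ((0 - of_nat (Suc k)) * (- 1) ^ k)"
    using Suc by (simp only:) (intro qcong_mult; simp del: of_nat_Suc)
  from qcong_divide_unit[OF this qcong_refl] Suc.prems
  show ?case by (simp del: of_nat_Suc)
qed simp

text \<open>The numerator (x+j-1)(x+j-2)...(x+j-p+1) contains the factor x, and d is the cofactor.
  Its residue follows by induction on j.\<close>

lemma gbinomial_p_minus_1_cong: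
  assumes "0 < j" "j < p"
  obtains d where "(x + of_nat j - 1) gchoose (p - 1) = x * d" "qcong p 1 d (1 / of_nat j)"
proof -
  have "\<exists>d. (x + of_nat j - 1) gchoose (p - 1) = x * d \<and> qcong p 1 d (1 / of_nat j)"
    using assms(1,2)
  proof (induction j rule: nat_induct_non_zero)
    case 1
    define d where "d = ((x - 1) gchoose (p - 2)) / of_nat (p - 1)"
    have "x gchoose (p - 1) = x * d"
      using gbinomial_absorption'[of "p - 1" x] p3 by (simp add: d_def numeral_2_eq_2)
    moreover have "qcong p 1 d 1"
    proof -
      have "\<not> p dvd p - 1" using p3 by (auto dest: dvd_imp_le)
      moreover have gb: "qcong p 1 ((x - 1) gchoose (p - 2)) ((- 1) ^ (p - 2))"
        using p3 by (intro gbinomial_minus_1_cong) simp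
      ultimately have dZ: "d \<in> Zloc p"
        unfolding d_def using qcong_Zloc[OF gb] by (intro Zloc_divide_of_nat) auto
      \<comment> \<open>Write d = p d - (p - 1) d; here (p - 1) d is the binomial coefficient
        congruent to (-1)^(p-2) = -1.\<close>
      have "qcong p 1 (of_nat p * d) 0" by (rule qcongI[OF dZ]) simp
      moreover have "(- 1 :: rat) ^ (p - 2) = - 1" using p_odd p3 by simp
      ultimately have "qcong p 1 (of_nat p * d - ((x - 1) gchoose (p - 2))) (0 - - 1)"
        using gb by (intro qcong_diff) simp_all
      moreover have "of_nat p * d - ((x - 1) gchoose (p - 2)) = d"
        using p3 by (simp add: d_def of_nat_diff field_simps)
      ultimately show ?thesis by simp
    qed
    ultimately show ?case by auto
  next
    case (Suc j)
    then obtain d where d: "(x + of_nat j - 1) gchoose (p - 1) = x * d" "qcong p 1 d (1 / of_nat j)"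
      by auto
    \<comment> \<open>Raising the upper argument by 1 multiplies the binomial coefficient by (x + j)
      / v, and v = x + (j + 1) - p is a unit congruent to j + 1.\<close>
    define v where "v = x + of_nat j - of_nat (p - 1)"
    define d' where "d' = (x + of_nat j) * d / v"
    have v: "qcong p 1 v (of_nat (Suc j))"
    proof -
      have "qcong p 1 (- of_nat p) 0" by (rule qcongI[of "- 1"]) simp_all
      from qcong_add[OF multiple_of_p_plus[of "Suc j"] this] show ?thesis
        using p3 by (simp add: v_def of_nat_diff algebra_simps)
    qed
    have v0: "v \<noteq> 0" using unit_nonzero[OF v] Suc.prems by simp
    have dZ: "d \<in> Zloc p"
      using d(2) Suc Zloc_divide_unit[OF qcong_refl] by (intro qcong_Zloc[OF d(2)]) simp
    then have d'Z: "d' \<in> Zloc p"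
      unfolding d'_def using Suc.prems by (intro Zloc_divide_unit[OF v]) auto
    have "v * ((x + of_nat j) gchoose (p - 1)) = (x + of_nat j) * (x * d)"
      using gbinomial_absorb_comp[of "x + of_nat j" "p - 1"] d(1) by (simp add: v_def)
    then have "(x + of_nat (Suc j) - 1) gchoose (p - 1) = x * d'"
      using v0 by (simp add: d'_def field_simps)
    moreover have "qcong p 1 d' (1 / of_nat (Suc j))"
    proof (rule qcong_divide_unit)
      have "qcong p 1 (d' * of_nat (Suc j)) (d' * v)"
        by (intro qcong_cmult d'Z qcong_sym[OF v])
      also have "d' * v = (x + of_nat j) * d" using v0 by (simp add: d'_def)
      also have "qcong p 1 ((x + of_nat j) * d) (of_nat j * (1 / of_nat j))"
        using Suc Zloc_divide_unit[OF qcong_refl] by (intro qcong_mult multiple_of_p_plus d(2)) auto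
      finally show "qcong p 1 (of_nat (Suc j) * d') 1"
        using Suc.hyps by (simp add: mult.commute)
    qed (use Suc.prems in simp_all)
    ultimately show ?case by blast
  qed
  then show ?thesis using that by blast
qed

text \<open>Absorption gives binom(x, k) = (x / k) binom(x-1, k-1), so modulo p^2 the sum is - x
  times the sum of all 1 / k^2, which is itself divisible by p.\<close>

lemma harmonic_gbinomial_multiple_of_p: "qcong p 2 (harmonic_gbinomial (p - 1) x) 0"
proof -
  have "qcong p 2 ((-1) ^ k / of_nat k * (x gchoose k)) (x * (- (1 / of_nat k ^ 2)))"
    if k: "k \<in> {1..p-1}" for k
  proof -
    have k': "0 < k" "k < p" using k p3 by auto
    have "(-1) ^ k / of_nat k * (x gchoose k)
        = x * ((-1) ^ k / of_nat k / of_nat k * ((x - 1) gchoose (k - 1)))"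
      using gbinomial_absorption'[of k x] k' by simp
    moreover have "qcong p 1 ((-1) ^ k / of_nat k / of_nat k * ((x - 1) gchoose (k - 1)))
        ((-1) ^ k / of_nat k / of_nat k * (-1) ^ (k - 1))"
      using k' by (intro qcong_cmult gbinomial_minus_1_cong Zloc_divide_unit[OF qcong_refl k']) auto
    moreover have "(-1) ^ k / of_nat k / of_nat k * (-1) ^ (k - 1) = (- (1 / of_nat k ^ 2) :: rat)"
      using k' by (cases k) (simp_all add: power2_eq_square flip: power_add mult_2)
    ultimately show ?thesis
      using qcong_0_mult_cong[OF x, of 1 "(-1) ^ k / of_nat k / of_nat k * ((x - 1) gchoose (k - 1))"
          "- (1 / of_nat k ^ 2)"]
      by (simp only: one_add_one)
  qed
  then have "qcong p 2 (harmonic_gbinomial (p - 1) x) (\<Sum>k=1..p-1. x * (- (1 / of_nat k ^ 2)))"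
    unfolding harmonic_gbinomial_def by (rule qcong_sum)
  also have "(\<Sum>k=1..p-1. x * (- (1 / of_nat k ^ 2))) = - (x * (\<Sum>k=1..p-1. 1 / of_nat k ^ 2))"
    by (simp add: sum_distrib_left sum_negf)
  also have "qcong p 2 \<dots> (- 0)"
    using qcong_0_mult[OF x sum_inverse_squares] by (intro qcong_minus) (simp only: one_add_one)
  finally show ?thesis by simp
qed

text \<open>The step to r + 1 adds (x d - 1) / (x + r + 1). The part with factor x is reduced to x /
  (r + 1)^2, whereas 1 / (x + r + 1) has no such factor and is kept exactly.\<close>

lemma harmonic_gbinomial_cong:
  "r < p \<Longrightarrow> qcong p 2 (harmonic_gbinomial (p - 1) (x + of_nat r))
    (x * (\<Sum>j=1..r. 1 / of_nat j ^ 2) - (\<Sum>j=1..r. 1 / (x + of_nat j)))"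
proof (induction r)
  case 0
  then show ?case using harmonic_gbinomial_multiple_of_p by simp
next
  case (Suc r)
  let ?u = "x + of_nat (Suc r)"
  note u = multiple_of_p_plus[of "Suc r"] and r = zero_less_Suc Suc.prems
  obtain d where d: "(?u - 1) gchoose (p - 1) = x * d" "qcong p 1 d (1 / of_nat (Suc r))"
    using gbinomial_p_minus_1_cong r by blast
  have u1: "?u - 1 = x + of_nat r" by simp
  have "qcong p 1 (d * (1 / ?u)) (1 / of_nat (Suc r) * (1 / of_nat (Suc r)))"
    using Zloc_divide_unit[OF qcong_refl r Zloc_1]
    by (intro qcong_mult unit_inverse[OF u r] d(2) qcong_Zloc[OF d(2)])
  then have *: "qcong p 2 (x * (d * (1 / ?u))) (x * (1 / of_nat (Suc r) ^ 2))"
    using qcong_0_mult_cong[OF x, of 1 "d * (1 / ?u)" "1 / of_nat (Suc r) * (1 / of_nat (Suc r))"]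
    by (simp add: power2_eq_square numeral_2_eq_2 del: of_nat_Suc)
  have "harmonic_gbinomial (p - 1) ?u
      = harmonic_gbinomial (p - 1) (x + of_nat r) + (((x + of_nat r) gchoose (p - 1)) - 1) / ?u"
    using harmonic_gbinomial_plus_1[of "x + of_nat r" "p - 1"] unit_nonzero[OF u r] p_odd
    by (simp add: add_ac)
  also have "\<dots> = harmonic_gbinomial (p - 1) (x + of_nat r) + (x * (d * (1 / ?u)) - 1 / ?u)"
    using d(1) unfolding u1 by (simp add: diff_divide_distrib)
  also have "qcong p 2 \<dots> (x * (\<Sum>j=1..r. 1 / of_nat j ^ 2) - (\<Sum>j=1..r. 1 / (x + of_nat j))
      + (x * (1 / of_nat (Suc r) ^ 2) - 1 / ?u))"
    using Suc by (intro qcong_add qcong_diff *) auto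
  finally show ?case by (simp add: algebra_simps del: of_nat_Suc)
qed

text \<open>The quotient is split at -x: \<open>bernpoly_N_quotient\<close> disposes of B_N(-x) -
  B_N, and the r unit steps from -x down to -(x + r) give powers with the odd exponent N - 1, hence
  the sign.\<close>

lemma bernoulli_N_quotient_cong:
  assumes "r < p"
  shows "qcong p 2 ((bernoulli N - bernpoly N (- (x + of_nat r))) / of_nat N)
    (- (\<Sum>j=1..r. 1 / (x + of_nat j)))"
proof -
  have N: "(of_nat N :: rat) \<noteq> 0" using N_gt by simp
  have pw: "qcong p 2 ((- x - of_nat j) ^ (N - 1)) (- (1 / (x + of_nat j)))" if "j \<in> {1..r}" for j
  proof -
    have "(- x - of_nat j) ^ (N - 1) = (- (x + of_nat j)) ^ (N - 1)" by simp
    also have "\<dots> = - ((x + of_nat j) ^ (N - 1))"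
      using N_even N_gt by (intro power_minus_odd) simp
    finally show ?thesis
      using that assms qcong_minus[OF unit_power_N[OF multiple_of_p_plus, of j]] by simp
  qed
  have mx: "qcong p 1 (- x) 0" using qcong_minus[OF x] by simp
  have "bernpoly N (- x) = bernpoly N (- (x + of_nat r))
      + of_nat N * (\<Sum>j=1..r. (- x - of_nat j) ^ (N - 1))"
    using bernpoly_minus_eq_sum[of N "- x" r] by simp
  then have "(bernoulli N - bernpoly N (- (x + of_nat r))) / of_nat N
      = - ((bernpoly N (- x) - bernoulli N) / of_nat N) + (\<Sum>j=1..r. (- x - of_nat j) ^ (N - 1))"
    using N by (simp add: field_simps)
  also have "qcong p 2 \<dots> (- 0 + (\<Sum>j=1..r. - (1 / (x + of_nat j))))"
    by (intro qcong_add qcong_minus bernpoly_N_quotient mx qcong_sum pw)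
  finally show ?thesis by (simp add: sum_negf)
qed

text \<open>The same descent from -x, where the value is congruent to B_(p-2) = 0. The factor 2 is
  the residue of -(p - 2).\<close>

lemma bernpoly_p_minus_2_cong:
  assumes "r < p"
  shows "qcong p 1 (bernpoly (p - 2) (- (x + of_nat r))) (2 * (\<Sum>j=1..r. 1 / of_nat j ^ 2))"
proof -
  have mx: "qcong p 1 (- x) 0" using qcong_minus[OF x] by simp
  have "bernoulli (p - 2) = 0" using p_odd p3 by (intro bernoulli_odd) auto
  then have b: "qcong p 1 (bernpoly (p - 2) (- x)) 0"
    using bernpoly_cong_bernoulli[OF mx, of "p - 2"] p3 by simp
  have pw: "qcong p 1 ((- x - of_nat j) ^ (p - 3)) (1 / of_nat j ^ 2)" if "j \<in> {1..r}" for j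
  proof -
    have "(- x - of_nat j) ^ (p - 3) = (- (x + of_nat j)) ^ (p - 3)" by simp
    also have "\<dots> = (x + of_nat j) ^ (p - 3)"
      using p_odd p3 by (intro power_minus_even) simp
    finally show ?thesis
      using that assms unit_power_p_minus_3[OF multiple_of_p_plus, of j] by simp
  qed
  have sq: "1 / of_nat j ^ 2 \<in> Zloc p" if "j \<in> {1..r}" for j
  proof -
    have "\<not> p dvd j ^ 2" using that assms p by (auto simp: prime_dvd_power_nat_iff dest: dvd_imp_le)
    then show ?thesis using Zloc_divide_of_nat[OF Zloc_1] by fastforce
  qed
  have "- (of_nat (p - 2) :: rat) = 2 + of_nat p ^ 1 * (- 1)" using p3 by (simp add: of_nat_diff)
  then have c: "qcong p 1 (- of_nat (p - 2)) 2" by (rule qcongI[rotated]) simp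
  have "bernpoly (p - 2) (- (x + of_nat r)) = bernpoly (p - 2) (- x)
      + (- of_nat (p - 2)) * (\<Sum>j=1..r. (- x - of_nat j) ^ (p - 3))"
    using bernpoly_minus_eq_sum[of "p - 2" "- x" r] by simp
  also have "qcong p 1 \<dots> (0 + 2 * (\<Sum>j=1..r. 1 / of_nat j ^ 2))"
    using qcong_Zloc[OF c] by (intro qcong_add b qcong_mult c qcong_sum pw Zloc_sum sq) auto
  finally show ?thesis by simp
qed

lemma harmonic_gbinomial_cong_bernoulli:
  assumes "r < p"
  shows "qcong p 2 (harmonic_gbinomial (p - 1) (x + of_nat r))
    ((bernoulli N - bernpoly N (- (x + of_nat r))) / of_nat N
      + x / 2 * bernpoly (p - 2) (- (x + of_nat r)))"
proof -
  let ?s = "\<Sum>j=1..r. 1 / of_nat j ^ 2 :: rat" and ?b = "bernpoly (p - 2) (- (x + of_nat r))"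
  have "\<not> p dvd 2" using p3 by (auto dest: dvd_imp_le)
  then have "1 / of_nat 2 \<in> Zloc p" by (intro Zloc_divide_of_nat) simp
  then have "qcong p 1 (1 / of_nat 2 * ?b) (1 / of_nat 2 * (2 * ?s))"
    by (intro qcong_cmult bernpoly_p_minus_2_cong assms)
  \<comment> \<open>The factor x lifts the congruence modulo p to one modulo p^2.\<close>
  then have "qcong p 2 (x / 2 * ?b) (x * ?s)"
    using qcong_0_mult_cong[OF x, of 1 "1 / of_nat 2 * ?b" ?s] by (simp add: numeral_2_eq_2)
  from qcong_add[OF bernoulli_N_quotient_cong[OF assms] this]
  have "qcong p 2 ((bernoulli N - bernpoly N (- (x + of_nat r))) / of_nat N + x / 2 * ?b)
      (x * ?s - (\<Sum>j=1..r. 1 / (x + of_nat j)))"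
    by simp
  then show ?thesis using harmonic_gbinomial_cong[OF assms] qcong_sym qcong_trans by blast
qed

end

end

end

theorem theorem6p1:
  fixes p :: nat and a :: rat
  assumes "prime p" and "p > 3"
    and "a \<in> Zloc p" and "\<not> qcong p 1 a 0"
  shows "qcong p 2
    (\<Sum>k=1..p-1. (-1) ^ k / of_nat k * (a gchoose k))
    ((bernoulli (p^2 * (p - 1)) - bernpoly (p^2 * (p - 1)) (- a)) / of_nat (p^2 * (p - 1))
      + (a - of_nat (qresidue p a)) / 2 * bernpoly (p - 2) (- a))"
proof -
  define r where "r = qresidue p a"
  have r: "r < p" "qcong p 1 a (of_nat r)"
    using theI'[OF ex1_qresidue[OF assms(1,3)]] by (simp_all add: r_def qresidue_def)
  from r(2) have "qcong p 1 (a - of_nat r) 0" by (simp add: qcong_def)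
  \<comment> \<open>Here x is a - r, so that x + r = a.\<close>
  from harmonic_gbinomial_cong_bernoulli[OF assms(1,2) refl this r(1)]
  show ?thesis by (simp add: harmonic_gbinomial_def flip: r_def)
qed

end
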